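(* Let $m\ge 0$ be an integer, let $0<\alpha\le 2$, and let $f$ be a measurable function on $\mathbf{R}$ satisfying $$\int_{\mathbf{R}}\frac{|f(\xi)|}{1+|\xi|^{2+m}}\,d\xi<\infty .$$ Let $v$ be the harmonic function on the upper half plane $\mathbf{C}_+$ defined by $$v(z)=\int_{\mathbf{R}}P_m(z,\xi)f(\xi)\,d\xi,\qquad z\in\mathbf{C}_+,$$ where $P_m$ is the modified Poisson kernel. Then there exist a (finite or infinite) sequence of points $z_j\in\mathbf{C}_+$ and numbers $\rho_j>0$ such that $$\sum_{j}\frac{\rho_j^{2-\alpha}}{|z_j|^{2-\alpha}}<\infty$$ and such that, with $G=\bigcup_{j}B(z_j,\rho_j)$, $$v(z)=o\left(y^{1-\alpha}|z|^{m+\alpha}\right)\quad\text{as } |z|\to\infty,\ z=x+iy\in\mathbf{C}_+\setminus G .$$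
   Context: $\mathbf{C}_+=\{z=x+iy\in\mathbf{C}: y>0\}$, and $B(z,\rho)$ is the open ball (disc) of radius $\rho$ centered at $z$ in $\mathbf{C}$. The Poisson kernel of $\mathbf{C}_+$ is $P(z,\xi)=\dfrac{y}{\pi|z-\xi|^2}$ for $z=x+iy\in\mathbf{C}_+$, $\xi\in\mathbf{R}$. The modified Poisson kernel is $$P_m(z,\xi)=\begin{cases}P(z,\xi), & |\xi|\le 1,\\[2pt] P(z,\xi)-\dfrac1\pi\,\Im\displaystyle\sum_{k=0}^{m}\frac{z^k}{\xi^{1+k}}, & |\xi|>1.\end{cases}$$ When $\alpha=2$ the summability condition means that there are only finitely many balls (each term equals $1$). The statement $v(z)=o(y^{1-\alpha}|z|^{m+\alpha})$ means: for every $\varepsilon>0$ there is $R>0$ such that $|v(z)|\le\varepsilon y^{1-\alpha}|z|^{m+\alpha}$ for all $z\in\mathbf{C}_+\setminus G$ with $|z|\ge R$. *)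

theory Defs
  imports "HOL-Analysis.Analysis" "HOL-Library.Extended_Nat"
begin

definition upper_half_plane :: "complex set" where
  "upper_half_plane = {z. Im z > 0}"

definition poisson_kernel :: "complex \<Rightarrow> real \<Rightarrow> real" where
  "poisson_kernel z \<xi> = Im z / (pi * (cmod (z - of_real \<xi>))\<^sup>2)"

definition modified_poisson_kernel :: "nat \<Rightarrow> complex \<Rightarrow> real \<Rightarrow> real" where
  "modified_poisson_kernel m z \<xi> =
    (if \<bar>\<xi>\<bar> \<le> 1 then poisson_kernel z \<xi>
     else poisson_kernel z \<xi> - 1 / pi * Im (\<Sum>k=0..m. z ^ k / of_real \<xi> ^ (1 + k)))"

definition modified_poisson_integral :: "nat \<Rightarrow> (real \<Rightarrow> real) \<Rightarrow> complex \<Rightarrow> real" where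
  "modified_poisson_integral m f z = (LINT \<xi>|lebesgue. modified_poisson_kernel m z \<xi> * f \<xi>)"

(* Little-o as |z| tends to infinity inside S, with the pointwise bound required for every
   z in S of large modulus. *)
definition little_o_at_infinity_within ::
  "(complex \<Rightarrow> real) \<Rightarrow> (complex \<Rightarrow> real) \<Rightarrow> complex set \<Rightarrow> bool" where
  "little_o_at_infinity_within v g S \<longleftrightarrow>
    (\<forall>\<epsilon>>0. \<exists>R>0. \<forall>z\<in>S. cmod z \<ge> R \<longrightarrow> \<bar>v z\<bar> \<le> \<epsilon> * g z)"

(* Index set of a finite (N < \<infinity>) or infinite (N = \<infinity>) sequence of length N. *)
definition seq_index :: "enat \<Rightarrow> nat set" where
  "seq_index N = {j. enat j < N}"

end

theory Submission
  imports Defs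
begin

text \<open>
  Let \<nu> be the finite measure with density |f(\<xi>)| / (1 + |\<xi>|^(2+m)). Since the modified kernel is
  Im (z^(m+1) / (\<xi>^(m+1) (\<xi> - z))) / \<pi>, it satisfies, up to a constant depending on m,
  (1 + |\<xi>|^(2+m)) |P_m(z,\<xi>)| \<le> y |z|^m (|\<xi>| + |z|) (|\<xi>| + 1) / |\<xi> - z|^2. Away from |\<xi>| \<approx> |z| the
  \<nu>-integral of this is o(y |z|^m) by dominated convergence. For |z|/2 \<le> |\<xi>| \<le> 2|z| one splits
  dyadically in |\<xi> - z| \<ge> y; this gives a convergent geometric series (as \<alpha> > 0) as soon as the
  \<nu>-mass of every disc B(z,t) is at most \<epsilon> (t/|z|)^(2-\<alpha>). The points violating this in the shell
  2^p \<le> |z| < 2^(p+1), with \<epsilon> = \<epsilon>_p, are covered by Vitali's lemma at cost (mass near the shell) / \<epsilon>_p,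
  and \<epsilon>_p can be chosen to tend to 0 so slowly that these costs are summable.
\<close>

section \<open>Slowly vanishing weights and enumeration of countable families\<close>

text \<open>With T_p the tail of the series from p on, a_p = T_p - T_(p+1) is a difference of
  squares of square roots. Dividing it by at least sqrt T_p leaves at most twice the telescoping
  difference sqrt T_p - sqrt T_(p+1).\<close>

lemma du_bois_reymond_weights:
  fixes a :: "nat \<Rightarrow> real"
  assumes a: "\<And>p. 0 \<le> a p" and "summable a"
  obtains e where "\<And>p. 0 < e p" "e \<longlonglongrightarrow> 0" "summable (\<lambda>p. a p / e p)"
proof -
  define T where "T p = (\<Sum>q. a (q + p))" for p
  \<comment> \<open>The summand (1/2)^p only keeps e positive when the tail vanishes.\<close>
  define e where "e p = sqrt (T p) + (1/2) ^ p" for p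
  have sm: "summable (\<lambda>q. a (q + p))" for p
    using assms(2) by (simp add: summable_iff_shift)
  have T0: "0 \<le> T p" for p
    unfolding T_def by (intro suminf_nonneg sm a)
  have Tstep: "T p = a p + T (Suc p)" for p
    unfolding T_def using suminf_split_head[OF sm[of p]] by simp
  have Tlim: "T \<longlonglongrightarrow> 0"
    unfolding T_def using suminf_exist_split2[OF assms(2)] .
  have e_pos: "0 < e p" for p
    unfolding e_def using T0[of p] by (intro add_nonneg_pos) auto
  have "(\<lambda>p. sqrt (T p) + (1/2) ^ p) \<longlonglongrightarrow> sqrt 0 + 0"
    by (intro tendsto_add tendsto_real_sqrt Tlim LIMSEQ_power_zero) auto
  then have e_lim: "e \<longlonglongrightarrow> 0"
    unfolding e_def by simp
  have step: "a p / e p \<le> 2 * (sqrt (T p) - sqrt (T (Suc p)))" for p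
  proof -
    define u w where "u = sqrt (T p)" and "w = sqrt (T (Suc p))"
    have uw: "0 \<le> w" "w \<le> u" "u\<^sup>2 = T p" "w\<^sup>2 = T (Suc p)"
      using T0 Tstep[of p] a[of p] by (auto simp: u_def w_def)
    have "a p = (u - w) * (u + w)"
      using uw Tstep[of p] by (simp add: algebra_simps power2_eq_square)
    also have "\<dots> \<le> (u - w) * (2 * e p)"
      using uw by (intro mult_left_mono) (auto simp: e_def u_def[symmetric] intro: add_increasing2)
    finally show ?thesis
      using e_pos[of p] by (simp add: u_def w_def field_simps)
  qed
  have "summable (\<lambda>p. 2 * (sqrt (T p) - sqrt (T (Suc p))))"
    by (intro summable_mult telescope_summable'[where c = "sqrt 0"] tendsto_real_sqrt Tlim)
  then have "summable (\<lambda>p. a p / e p)"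
    by (rule summable_comparison_test_ev[rotated])
       (use step a e_pos in \<open>auto intro!: always_eventually simp: abs_of_nonneg less_imp_le\<close>)
  with e_pos e_lim show thesis by (rule that)
qed

text \<open>Bridge from the countable set of discs found by covering to the finite or infinite
  sequence that the theorem asks for.\<close>

lemma countable_enumeration_seq_index:
  assumes "countable J"
  obtains N g where "bij_betw g (seq_index N) J"
proof (cases "finite J")
  case True
  have "bij_betw (from_nat_into J) (seq_index (enat (card J))) J"
    using bij_betw_from_nat_into_finite[OF True] by (simp add: seq_index_def lessThan_def)
  then show thesis by (rule that)
next
  case False
  have "bij_betw (from_nat_into J) (seq_index \<infinity>) J"
    using bij_betw_from_nat_into[OF assms False] by (simp add: seq_index_def)
  then show thesis by (rule that)
qed

section \<open>The modified Poisson kernel: closed form and size\<close>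

text \<open>In polar form this is |sin (k t)| <= k |sin t|. The extra factor |z| on both sides
  avoids the exponent k - 1, so that k = 0 is covered. The induction expands Im (z * z^k) into real
  and imaginary parts.\<close>

lemma abs_Im_power_le: "\<bar>Im (z ^ k)\<bar> * cmod z \<le> real k * \<bar>Im z\<bar> * cmod z ^ k"
proof (induction k)
  case (Suc k)
  have "\<bar>Im (z ^ Suc k)\<bar> \<le> \<bar>Re z\<bar> * \<bar>Im (z ^ k)\<bar> + \<bar>Im z\<bar> * \<bar>Re (z ^ k)\<bar>"
    by (simp flip: abs_mult)
  also have "\<dots> \<le> cmod z * \<bar>Im (z ^ k)\<bar> + \<bar>Im z\<bar> * cmod z ^ k"
    by (intro add_mono mult_mono) (auto simp: abs_Re_le_cmod simp flip: norm_power)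
  also have "\<dots> \<le> real (Suc k) * \<bar>Im z\<bar> * cmod z ^ k"
    using Suc by (simp add: algebra_simps)
  finally show ?case
    using mult_right_mono[of _ _ "cmod z"] by (fastforce simp: algebra_simps)
qed auto

text \<open>The Poisson kernel is Im (1 / (\<xi> - z)) / pi, and the subtracted sum is the start of
  the geometric expansion of 1 / (\<xi> - z) in powers of z / \<xi>, so only its remainder survives.
  Making the denominator real produces z^(m+1) (\<xi> - cnj z) = \<xi> z^(m+1) - |z|^2 z^m. In this
  form the imaginary parts of pure powers of z yield the factor y.\<close>

lemma modified_poisson_kernel_eq:
  assumes "0 < Im z" "1 < \<bar>\<xi>\<bar>"
  shows "modified_poisson_kernel m z \<xi> =
    (\<xi> * Im (z ^ (m + 1)) - (cmod z)\<^sup>2 * Im (z ^ m)) / (pi * \<xi> ^ (m + 1) * (cmod (z - of_real \<xi>))\<^sup>2)"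
proof -
  define x :: complex where "x = of_real \<xi>"
  have nz: "x \<noteq> 0" "x - z \<noteq> 0"
    using assms by (auto simp: x_def complex_eq_iff)
  have geo: "(\<Sum>k=0..m. z ^ k / x ^ (1 + k)) = 1 / (x - z) - z ^ (m + 1) / (x ^ (m + 1) * (x - z))"
  proof (induction m)
    case 0
    have "1 / (x - z) - z / (x * (x - z)) = (x - z) / (x * (x - z))"
      using nz by (simp add: divide_simps)
    then show ?case using nz by simp
  next
    case (Suc m)
    \<comment> \<open>For \<open>a = z ^ (m + 1)\<close> and \<open>b = x ^ (m + 1)\<close>:
      subtracting one more summand \<open>a / (x * b)\<close> multiplies the remainder by z /
      x.\<close>
    have tele: "a / (x * b) = a / (b * (x - z)) - z * a / (x * b * (x - z))" if "b \<noteq> 0" for a b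
    proof -
      have "a / (b * (x - z)) - z * a / (x * b * (x - z)) = (a * (x - z)) / (x * b * (x - z))"
        using that nz by (simp add: divide_simps) (simp add: algebra_simps)
      then show ?thesis using nz by simp
    qed
    show ?case
      unfolding sum.atLeast0_atMost_Suc Suc
      using tele[of "x ^ (m + 1)" "z ^ (m + 1)"] nz by (simp add: mult.assoc)
  qed
  have inv: "1 / (x - z) = (x - cnj z) / of_real ((cmod (z - x))\<^sup>2)"
  proof -
    have "of_real ((cmod (z - x))\<^sup>2) = (x - z) * (x - cnj z)"
      unfolding complex_norm_square by (simp add: x_def algebra_simps)
    moreover have "x - cnj z \<noteq> 0"
      using assms by (auto simp: x_def complex_eq_iff)
    ultimately show ?thesis using nz by (simp add: field_simps)
  qed
  have Pk: "poisson_kernel z \<xi> = 1 / pi * Im (1 / (x - z))"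
    unfolding inv Im_divide_of_real poisson_kernel_def by (simp add: x_def)
  have "z ^ (m + 1) / (x ^ (m + 1) * (x - z)) = z ^ (m + 1) / x ^ (m + 1) * (1 / (x - z))"
    by simp
  also have "\<dots> = z ^ (m + 1) * (x - cnj z) / of_real (\<xi> ^ (m + 1) * (cmod (z - x))\<^sup>2)"
    unfolding inv by (simp add: x_def)
  also have "z ^ (m + 1) * (x - cnj z) = of_real \<xi> * z ^ (m + 1) - of_real ((cmod z)\<^sup>2) * z ^ m"
    unfolding complex_norm_square by (simp add: x_def algebra_simps)
  finally have "Im (z ^ (m + 1) / (x ^ (m + 1) * (x - z))) =
    (\<xi> * Im (z ^ (m + 1)) - (cmod z)\<^sup>2 * Im (z ^ m)) / (\<xi> ^ (m + 1) * (cmod (z - x))\<^sup>2)"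
    by (simp only: Im_divide_of_real) (simp del: of_real_power power_Suc)
  moreover have "modified_poisson_kernel m z \<xi> = 1 / pi * Im (z ^ (m + 1) / (x ^ (m + 1) * (x - z)))"
    using assms unfolding modified_poisson_kernel_def Pk x_def[symmetric] geo
    by (simp add: diff_divide_distrib)
  ultimately show ?thesis
    by (simp add: x_def)
qed

text \<open>For |\<xi>| > 1 the weight is at most 2 |\<xi>|^(2+m), which cancels the power of \<xi>
  in the denominator of the closed form and leaves one factor |\<xi>|. For |\<xi>| <= 1 the plain
  Poisson kernel is compared crudely. The factor |\<xi>| + 1 serves both cases.\<close>

lemma modified_poisson_kernel_bound:
  assumes "0 < Im z" "1 \<le> cmod z"
  shows "\<bar>modified_poisson_kernel m z \<xi>\<bar> * (1 + \<bar>\<xi>\<bar> ^ (2 + m)) \<le>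
    2 * real (m + 1) * Im z * cmod z ^ m * ((\<bar>\<xi>\<bar> + cmod z) * (\<bar>\<xi>\<bar> + 1) / (cmod (z - of_real \<xi>))\<^sup>2)"
proof -
  define y r q where "y = Im z" and "r = cmod z" and "q = (cmod (z - of_real \<xi>))\<^sup>2"
  have pos: "0 < y" "1 \<le> r" "0 < q"
    using assms by (auto simp: y_def r_def q_def complex_eq_iff)
  have pi1: "1 \<le> pi" using pi_gt3 by simp
  show ?thesis
  proof (cases "\<bar>\<xi>\<bar> \<le> 1")
    case True
    have "\<bar>modified_poisson_kernel m z \<xi>\<bar> * (1 + \<bar>\<xi>\<bar> ^ (2 + m)) \<le> (y / q) * 2"
    proof (rule mult_mono)
      show "\<bar>modified_poisson_kernel m z \<xi>\<bar> \<le> y / q"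
        using True pos pi1
        by (simp add: modified_poisson_kernel_def poisson_kernel_def flip: y_def q_def)
           (simp add: field_simps)
      show "1 + \<bar>\<xi>\<bar> ^ (2 + m) \<le> 2"
        using True power_le_one[of "\<bar>\<xi>\<bar>" "2 + m"] by simp
    qed (use pos in auto)
    \<comment> \<open>The unit factors are placed for a factorwise comparison: m + 1, |z|^m, |\<xi>|
      + |z| and |\<xi>| + 1 are all at least 1.\<close>
    also have "\<dots> = 2 * 1 * y * 1 * (1 * 1 / q)" by simp
    also have "\<dots> \<le> 2 * real (m + 1) * y * r ^ m * ((\<bar>\<xi>\<bar> + r) * (\<bar>\<xi>\<bar> + 1) / q)"
      using pos by (intro mult_mono divide_right_mono) auto
    finally show ?thesis by (simp add: y_def r_def q_def)
  next
    case False
    then have x1: "1 < \<bar>\<xi>\<bar>" by simp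
    define s where "s = \<bar>\<xi>\<bar>"
    have s1: "1 < s" using x1 by (simp add: s_def)
    have "\<bar>Im (z ^ (m + 1))\<bar> * r \<le> real (m + 1) * y * r ^ m * r"
      using abs_Im_power_le[of z "m + 1"] pos by (simp add: y_def r_def algebra_simps)
    then have i1: "\<bar>Im (z ^ (m + 1))\<bar> \<le> real (m + 1) * y * r ^ m"
      using pos by simp
    \<comment> \<open>One of the two factors \<open>r\<close> in front of \<open>Im (z ^ m)\<close>
      is spent here; the other one remains and forms \<open>s + r\<close>.\<close>
    have "\<bar>Im (z ^ m)\<bar> * r \<le> real m * y * r ^ m"
      using abs_Im_power_le[of z m] pos by (simp add: y_def r_def)
    also have "\<dots> \<le> real (m + 1) * y * r ^ m"
      using pos by (intro mult_right_mono) auto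
    finally have i2: "\<bar>Im (z ^ m)\<bar> * r \<le> real (m + 1) * y * r ^ m" .
    have "\<bar>\<xi> * Im (z ^ (m + 1)) - r\<^sup>2 * Im (z ^ m)\<bar> \<le> s * \<bar>Im (z ^ (m + 1))\<bar> + r * (\<bar>Im (z ^ m)\<bar> * r)"
      using pos by (intro order.trans[OF abs_triangle_ineq4]) (simp add: s_def abs_mult power2_eq_square)
    also have "\<dots> \<le> s * (real (m + 1) * y * r ^ m) + r * (real (m + 1) * y * r ^ m)"
      using i1 i2 s1 pos by (intro add_mono mult_left_mono) auto
    also have "\<dots> = real (m + 1) * y * r ^ m * (s + r)"
      by (simp add: algebra_simps)
    finally have num: "\<bar>\<xi> * Im (z ^ (m + 1)) - r\<^sup>2 * Im (z ^ m)\<bar> \<le> real (m + 1) * y * r ^ m * (s + r)" .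
    have "\<bar>modified_poisson_kernel m z \<xi>\<bar>
        = \<bar>\<xi> * Im (z ^ (m + 1)) - r\<^sup>2 * Im (z ^ m)\<bar> / (pi * s ^ (m + 1) * q)"
      unfolding modified_poisson_kernel_eq[OF assms(1) x1]
      by (simp add: abs_mult power_abs r_def q_def s_def)
    also have "\<dots> \<le> real (m + 1) * y * r ^ m * (s + r) / (1 * s ^ (m + 1) * q)"
      using num pi1 pos s1 by (intro frac_le mult_right_mono) auto
    finally have k: "\<bar>modified_poisson_kernel m z \<xi>\<bar> \<le> real (m + 1) * y * r ^ m * (s + r) / (s ^ (m + 1) * q)"
      by simp
    have "\<bar>modified_poisson_kernel m z \<xi>\<bar> * (1 + s ^ (2 + m))
        \<le> (real (m + 1) * y * r ^ m * (s + r) / (s ^ (m + 1) * q)) * (2 * s ^ (2 + m))"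
      using k s1 pos one_le_power[of s "2 + m"] by (intro mult_mono) auto
    also have "\<dots> = 2 * real (m + 1) * y * r ^ m * ((s + r) * s / q)"
      using s1 pos by (simp add: field_simps)
    also have "\<dots> \<le> 2 * real (m + 1) * y * r ^ m * ((s + r) * (s + 1) / q)"
      using s1 pos by (intro mult_left_mono divide_right_mono) auto
    finally show ?thesis by (simp add: y_def r_def q_def s_def)
  qed
qed

section \<open>Exceptional discs by Vitali covering\<close>

text \<open>The trace of the open disc B(z,t) on the real line, cut down to |\<xi>| comparable with
  |z|. Because of the cut, the windows of all points of one dyadic shell lie in one ring, whatever t
  is.\<close>

definition window :: "complex \<Rightarrow> real \<Rightarrow> real set" where
  "window z t = {\<xi>. cmod z / 2 \<le> \<bar>\<xi>\<bar> \<and> \<bar>\<xi>\<bar> \<le> 2 * cmod z \<and> cmod (z - of_real \<xi>) < t}"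

lemma window_borel: "window z t \<in> sets borel"
  unfolding window_def by measurable

text \<open>The rings overlap, but each is covered by four consecutive members of a disjoint family,
  whose masses have a finite sum because \<nu> is finite.\<close>

lemma summable_measure_dyadic_rings:
  fixes \<nu> :: "real measure"
  assumes "finite_measure \<nu>" and sets: "sets borel \<subseteq> sets \<nu>"
  shows "summable (\<lambda>p::nat. measure \<nu> {\<xi>. 2 ^ p / 2 \<le> \<bar>\<xi>\<bar> \<and> \<bar>\<xi>\<bar> \<le> 4 * 2 ^ p})"
proof -
  interpret finite_measure \<nu> by fact
  define E where "E q = {\<xi>::real. 2 ^ q / 2 \<le> \<bar>\<xi>\<bar> \<and> \<bar>\<xi>\<bar> < 2 ^ q}" for q :: nat
  have "E q \<in> sets borel" for q unfolding E_def by measurable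
  then have E_sets: "E q \<in> sets \<nu>" for q using sets by auto
  have "E q \<inter> E q' = {}" if "q < q'" for q q'
  proof -
    have "(2::real) ^ Suc q \<le> 2 ^ q'" using that by (intro power_increasing) auto
    then show ?thesis by (auto simp: E_def)
  qed
  then have "disjoint_family E"
    unfolding disjoint_family_on_def by (metis Int_commute linorder_neq_iff)
  then have E_sum: "summable (\<lambda>q. measure \<nu> (E q))"
    using finite_measure_UNION[of E] E_sets by (auto intro: sums_summable)
  have "summable (\<lambda>p. measure \<nu> (E p) + measure \<nu> (E (p + 1)) + measure \<nu> (E (p + 2)) + measure \<nu> (E (p + 3)))"
    by (intro summable_add summable_ignore_initial_segment E_sum)
  then show ?thesis
  proof (rule summable_comparison_test'[where N = 0])
    fix p :: nat
    \<comment> \<open>\<open>E (p + 3)\<close> catches the closed endpoint |\<xi>| = 4 * 2^p, which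
      the half-open \<open>E (p + 2)\<close> omits.\<close>
    have "{\<xi>::real. 2 ^ p / 2 \<le> \<bar>\<xi>\<bar> \<and> \<bar>\<xi>\<bar> \<le> 4 * 2 ^ p} \<subseteq> E p \<union> E (p + 1) \<union> E (p + 2) \<union> E (p + 3)"
      by (auto simp: E_def power_add)
    then have "measure \<nu> {\<xi>. 2 ^ p / 2 \<le> \<bar>\<xi>\<bar> \<and> \<bar>\<xi>\<bar> \<le> 4 * 2 ^ p} \<le> measure \<nu> (E p \<union> E (p + 1) \<union> E (p + 2) \<union> E (p + 3))"
      using E_sets by (intro finite_measure_mono) auto
    also have "\<dots> \<le> measure \<nu> (E p) + measure \<nu> (E (p + 1)) + measure \<nu> (E (p + 2)) + measure \<nu> (E (p + 3))"
      using E_sets by (intro order.trans[OF measure_Un_le] add_mono) auto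
    finally show "norm (measure \<nu> {\<xi>. 2 ^ p / 2 \<le> \<bar>\<xi>\<bar> \<and> \<bar>\<xi>\<bar> \<le> 4 * 2 ^ p}) \<le> \<dots>"
      by simp
  qed
qed

text \<open>Disjoint Vitali discs cut disjoint windows out of one ring, and each window carries mass
  above e (r / |z|)^\<beta>; adding up gives the cost. The bound is stated for finite subsets, which
  is the form needed when all shells are summed together.\<close>

lemma bad_points_cover:
  fixes \<nu> :: "real measure" and p :: nat
  assumes "finite_measure \<nu>" and sets: "sets borel \<subseteq> sets \<nu>" and "0 < e"
    and K: "\<And>z. z \<in> K \<Longrightarrow> 2 ^ p \<le> cmod z \<and> cmod z < 2 ^ Suc p \<and> 0 < r z \<and> r z \<le> 6 * cmod z \<and>
      e * (r z / cmod z) powr \<beta> < measure \<nu> (window z (r z))"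
  shows "\<exists>C. countable C \<and> C \<subseteq> K \<and> K \<subseteq> (\<Union>z\<in>C. cball z (5 * r z)) \<and>
    (\<forall>F. finite F \<longrightarrow> F \<subseteq> C \<longrightarrow> (\<Sum>z\<in>F. (r z / cmod z) powr \<beta>)
      \<le> measure \<nu> {\<xi>. 2 ^ p / 2 \<le> \<bar>\<xi>\<bar> \<and> \<bar>\<xi>\<bar> \<le> 4 * 2 ^ p} / e)"
proof -
  interpret finite_measure \<nu> by fact
  let ?D = "{\<xi>::real. 2 ^ p / 2 \<le> \<bar>\<xi>\<bar> \<and> \<bar>\<xi>\<bar> \<le> 4 * 2 ^ p}"
  have "K \<subseteq> (\<Union>z\<in>K. cball z (r z))"
    using K by (force intro: less_imp_le)
  \<comment> \<open>Vitali's lemma requires bounded radii; the restriction to r <= 6 |z| inside one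
    shell provides the bound.\<close>
  moreover have "0 < r z \<and> r z \<le> 6 * 2 ^ Suc p" if "z \<in> K" for z
    using K[OF that] by auto
  ultimately obtain C where C: "countable C" "C \<subseteq> K"
    "pairwise (\<lambda>i j. disjnt (cball i (r i)) (cball j (r j))) C" "K \<subseteq> (\<Union>i\<in>C. cball i (5 * r i))"
    by (rule Vitali_covering_lemma_cballs)
  show ?thesis
  proof (intro exI conjI allI impI)
    show "countable C" "C \<subseteq> K" "K \<subseteq> (\<Union>z\<in>C. cball z (5 * r z))"
      using C by auto
    fix F assume F: "finite F" "F \<subseteq> C"
    have W: "window z t \<in> sets \<nu>" for z t
      using window_borel sets by auto
    have "e * (\<Sum>z\<in>F. (r z / cmod z) powr \<beta>) \<le> (\<Sum>z\<in>F. measure \<nu> (window z (r z)))"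
      unfolding sum_distrib_left using F C(2) K by (intro sum_mono less_imp_le) auto
    also have "\<dots> = measure \<nu> (\<Union>z\<in>F. window z (r z))"
    proof (rule finite_measure_finite_Union[symmetric])
      show "disjoint_family_on (\<lambda>z. window z (r z)) F"
      unfolding disjoint_family_on_def
      proof (intro ballI impI)
        fix i j assume "i \<in> F" "j \<in> F" "i \<noteq> j"
        then have "disjnt (cball i (r i)) (cball j (r j))"
          using C(3) F(2) by (auto simp: pairwise_def)
        moreover have "complex_of_real \<xi> \<in> cball z (r z)" if "\<xi> \<in> window z (r z)" for z \<xi>
          using that by (simp add: window_def dist_norm)
        ultimately show "window i (r i) \<inter> window j (r j) = {}"
          unfolding disjnt_def by blast
      qed
    qed (use F W in auto)
    also have "\<dots> \<le> measure \<nu> ?D"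
    proof (rule finite_measure_mono)
      have "?D \<in> sets borel" by measurable
      then show "?D \<in> sets \<nu>" using sets by auto
      show "(\<Union>z\<in>F. window z (r z)) \<subseteq> ?D"
        using F(2) C(2) K by (fastforce simp: window_def)
    qed
    finally show "(\<Sum>z\<in>F. (r z / cmod z) powr \<beta>) \<le> measure \<nu> ?D / e"
      using \<open>0 < e\<close> by (simp add: field_simps)
  qed
qed

text \<open>The shells are covered one by one with thresholds \<open>e p\<close> for which the total
  cost converges. A point outside all discs cannot be bad in its own shell, which is the last
  conclusion.\<close>

lemma exceptional_balls:
  fixes \<nu> :: "real measure" and \<beta> :: real
  assumes "finite_measure \<nu>" and "sets borel \<subseteq> sets \<nu>"
  obtains e N c \<rho> where
    "\<And>p. 0 < e p" "e \<longlonglongrightarrow> 0"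
    "\<And>j. j \<in> seq_index N \<Longrightarrow> c j \<in> upper_half_plane \<and> 0 < \<rho> j"
    "(\<lambda>j. (\<rho> j / cmod (c j)) powr \<beta>) summable_on seq_index N"
    "\<And>p z t. z \<in> upper_half_plane - (\<Union>j\<in>seq_index N. ball (c j) (\<rho> j)) \<Longrightarrow>
      2 ^ p \<le> cmod z \<Longrightarrow> cmod z < 2 ^ Suc p \<Longrightarrow> 0 < t \<Longrightarrow> t \<le> 6 * cmod z \<Longrightarrow>
      measure \<nu> (window z t) \<le> e p * (t / cmod z) powr \<beta>"
proof -
  let ?D = "\<lambda>p::nat. {\<xi>::real. 2 ^ p / 2 \<le> \<bar>\<xi>\<bar> \<and> \<bar>\<xi>\<bar> \<le> 4 * 2 ^ p}"
  obtain e where e: "\<And>p. 0 < e p" "e \<longlonglongrightarrow> 0" "summable (\<lambda>p. measure \<nu> (?D p) / e p)"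
    using du_bois_reymond_weights[OF measure_nonneg summable_measure_dyadic_rings[OF assms]] by blast
  define bad where "bad p z t \<longleftrightarrow> 0 < t \<and> t \<le> 6 * cmod z \<and>
    e p * (t / cmod z) powr \<beta> < measure \<nu> (window z t)" for p z t
  \<comment> \<open>Larger t are irrelevant: a point of the window has distance at most 3|z| from z.\<close>
  define K where "K p = {z \<in> upper_half_plane. 2 ^ p \<le> cmod z \<and> cmod z < 2 ^ Suc p \<and> (\<exists>t. bad p z t)}" for p
  define r where "r p z = (SOME t. bad p z t)" for p z
  have r: "bad p z (r p z)" if "z \<in> K p" for p z
    using that unfolding K_def r_def by (auto intro: someI)
  have ex: "\<exists>C. countable C \<and> C \<subseteq> K p \<and> K p \<subseteq> (\<Union>z\<in>C. cball z (5 * r p z)) \<and>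
    (\<forall>F. finite F \<longrightarrow> F \<subseteq> C \<longrightarrow> (\<Sum>z\<in>F. (r p z / cmod z) powr \<beta>) \<le> measure \<nu> (?D p) / e p)" for p
  proof -
    have bad: "2 ^ p \<le> cmod z \<and> cmod z < 2 ^ Suc p \<and> 0 < r p z \<and> r p z \<le> 6 * cmod z \<and>
      e p * (r p z / cmod z) powr \<beta> < measure \<nu> (window z (r p z))" if "z \<in> K p" for z
      using r[OF that] that by (simp add: bad_def K_def)
    show ?thesis
      by (rule bad_points_cover[OF assms e(1) bad])
  qed
  obtain C where C_all: "\<forall>p. countable (C p) \<and> C p \<subseteq> K p \<and> K p \<subseteq> (\<Union>z\<in>C p. cball z (5 * r p z)) \<and>
    (\<forall>F. finite F \<longrightarrow> F \<subseteq> C p \<longrightarrow> (\<Sum>z\<in>F. (r p z / cmod z) powr \<beta>) \<le> measure \<nu> (?D p) / e p)"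
    by (rule exE[OF choice[OF allI[OF ex]]])
  have C: "countable (C p)" "C p \<subseteq> K p" "K p \<subseteq> (\<Union>z\<in>C p. cball z (5 * r p z))"
    "\<And>F. finite F \<Longrightarrow> F \<subseteq> C p \<Longrightarrow> (\<Sum>z\<in>F. (r p z / cmod z) powr \<beta>) \<le> measure \<nu> (?D p) / e p" for p
    using spec[OF C_all, of p] by simp_all
  \<comment> \<open>Pairs keep the shell index, since the selected radius \<open>r p z\<close>
    depends on \<open>p\<close>.\<close>
  define J where "J = Sigma UNIV C"
  \<comment> \<open>The factor 6: the covering discs are closed of radius 5 r, and since r > 0 the
    open discs of radius 6 r contain them.\<close>
  define w where "w = (\<lambda>(p, z). (6 * r p z / cmod z) powr \<beta>)"
  have J_K: "z \<in> K p" if "(p, z) \<in> J" for p z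
    using that C(2) by (auto simp: J_def)
  have w_sum: "w summable_on J"
  proof (rule nonneg_bdd_above_summable_on)
    show "0 \<le> w x" for x by (simp add: w_def split: prod.split)
    \<comment> \<open>A finite part of \<open>J\<close> is sliced by shells. Each slice is bounded
      by the cost of its shell, and the costs form a convergent series.\<close>
    show "bdd_above (sum w ` {F. F \<subseteq> J \<and> finite F})"
    proof (rule bdd_aboveI2)
      fix F assume "F \<in> {F. F \<subseteq> J \<and> finite F}"
      then have F: "F \<subseteq> J" "finite F" by auto
      define S where "S p = {z. (p, z) \<in> F}" for p
      have fS: "finite (S p)" for p
        by (rule finite_subset[OF _ finite_imageI[OF F(2), of snd]]) (force simp: S_def)
      have SC: "S p \<subseteq> C p" for p
        using F(1) by (auto simp: S_def J_def)
      have F_eq: "F = Sigma (fst ` F) S"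
        by (force simp: S_def)
      have "sum w F = sum w (Sigma (fst ` F) S)"
        by (rule arg_cong[OF F_eq])
      also have "\<dots> = (\<Sum>p\<in>fst ` F. \<Sum>z\<in>S p. w (p, z))"
        using F(2) fS by (subst sum.Sigma) (auto simp: w_def case_prod_beta)
      also have "\<dots> \<le> (\<Sum>p\<in>fst ` F. 6 powr \<beta> * (measure \<nu> (?D p) / e p))"
      proof (rule sum_mono)
        fix p
        have "(\<Sum>z\<in>S p. w (p, z)) = 6 powr \<beta> * (\<Sum>z\<in>S p. (r p z / cmod z) powr \<beta>)"
          unfolding sum_distrib_left w_def
        proof (intro sum.cong refl, simp)
          fix z assume "z \<in> S p"
          then have "z \<in> K p" using SC C(2) by blast
          from r[OF this] have "0 < r p z" by (simp add: bad_def)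
          then show "(6 * r p z / cmod z) powr \<beta> = 6 powr \<beta> * (r p z / cmod z) powr \<beta>"
            using powr_mult[of 6 "r p z / cmod z" \<beta>] by simp
        qed
        then show "(\<Sum>z\<in>S p. w (p, z)) \<le> 6 powr \<beta> * (measure \<nu> (?D p) / e p)"
          by (simp only:) (rule mult_left_mono[OF C(4)[OF fS SC]], simp)
      qed
      also have "\<dots> = 6 powr \<beta> * (\<Sum>p\<in>fst ` F. measure \<nu> (?D p) / e p)"
        by (simp add: sum_distrib_left)
      also have "\<dots> \<le> 6 powr \<beta> * (\<Sum>p. measure \<nu> (?D p) / e p)"
        using F less_imp_le[OF e(1)]
        by (intro mult_left_mono sum_le_suminf e(3)) (auto intro: divide_nonneg_nonneg)
      finally show "sum w F \<le> \<dots>" .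
    qed
  qed
  have "countable J"
    unfolding J_def using C(1) by (intro countable_SIGMA) auto
  then obtain N g where g: "bij_betw g (seq_index N) J"
    by (rule countable_enumeration_seq_index)
  define c where "c j = snd (g j)" for j
  define \<rho> where "\<rho> j = 6 * r (fst (g j)) (c j)" for j
  have gJ: "c j \<in> K (fst (g j))" if "j \<in> seq_index N" for j
    using J_K[of "fst (g j)" "snd (g j)"] bij_betwE[OF g] that by (simp add: c_def)
  show thesis
  proof (rule that[OF e(1,2)])
    show "c j \<in> upper_half_plane \<and> 0 < \<rho> j" if "j \<in> seq_index N" for j
      using gJ[OF that] r[OF gJ[OF that]] by (simp add: K_def bad_def \<rho>_def)
    show "(\<lambda>j. (\<rho> j / cmod (c j)) powr \<beta>) summable_on seq_index N"
      using w_sum summable_on_reindex_bij_betw[OF g, of w]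
      by (simp add: w_def c_def \<rho>_def case_prod_beta)
    fix p z t
    assume z: "z \<in> upper_half_plane - (\<Union>j\<in>seq_index N. ball (c j) (\<rho> j))"
      and p: "2 ^ p \<le> cmod z" "cmod z < 2 ^ Suc p" and t: "0 < t" "t \<le> 6 * cmod z"
    show "measure \<nu> (window z t) \<le> e p * (t / cmod z) powr \<beta>"
    proof (rule ccontr)
      assume "\<not> ?thesis"
      then have "z \<in> K p" using z p t by (auto simp: K_def bad_def)
      then obtain x where x: "x \<in> C p" "z \<in> cball x (5 * r p x)" using C(3) by blast
      then have "x \<in> K p" using C(2) by blast
      from r[OF this] have "0 < r p x" by (simp add: bad_def)
      with x have zx: "z \<in> ball x (6 * r p x)" by auto
      have "(p, x) \<in> J" using x by (simp add: J_def)
      then obtain j where "j \<in> seq_index N" "g j = (p, x)"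
        using bij_betw_imp_surj_on[OF g] by (metis imageE)
      then have "z \<in> (\<Union>j\<in>seq_index N. ball (c j) (\<rho> j))"
        using zx by (intro UN_I[of j]) (auto simp: c_def \<rho>_def)
      with z show False by simp
    qed
  qed
qed

section \<open>Dyadic splitting around z and the integral estimate\<close>

text \<open>With s = 2^k y, the hypothesis on masses at t = 2 s bounds the k-th term by a constant
  times s^(-\<alpha>) |z|^(\<alpha>-2), a geometric sequence of ratio 2^(-\<alpha>) < 1. The
  restriction s <= 3 |z| keeps t within the admissible range.\<close>

lemma dyadic_window_sum:
  fixes \<nu> :: "real measure"
  assumes "0 < \<alpha>" "0 < y" "z \<noteq> 0" "0 \<le> e"
    and good: "\<And>t. 0 < t \<Longrightarrow> t \<le> 6 * cmod z \<Longrightarrow> measure \<nu> (window z t) \<le> e * (t / cmod z) powr (2 - \<alpha>)"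
    and S: "finite S" "\<And>k. k \<in> S \<Longrightarrow> 2 ^ k * y \<le> 3 * cmod z"
  shows "(\<Sum>k\<in>S. measure \<nu> (window z (2 * (2 ^ k * y))) / (2 ^ k * y)\<^sup>2)
    \<le> 4 / (1 - 2 powr - \<alpha>) * e * (y powr - \<alpha> * cmod z powr (\<alpha> - 2))"
proof -
  define q where "q = 2 powr - \<alpha>"
  define A where "A = y powr - \<alpha> * cmod z powr (\<alpha> - 2)"
  have q: "0 < q" "q < 1"
    using assms(1) by (auto simp: q_def powr_less_one)
  have z: "0 < cmod z" using assms by simp
  have A0: "0 \<le> A" by (simp add: A_def)
  have "(\<Sum>k\<in>S. measure \<nu> (window z (2 * (2 ^ k * y))) / (2 ^ k * y)\<^sup>2) \<le> (\<Sum>k\<in>S. 4 * e * A * q ^ k)"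
  proof (rule sum_mono)
    fix k assume k: "k \<in> S"
    define s where "s = 2 ^ k * y"
    have s0: "0 < s" "s \<le> 3 * cmod z"
      using assms(2) S(2)[OF k] by (simp_all add: s_def)
    then have s: "0 < s" "2 * s \<le> 6 * cmod z" by linarith+
    have s_powr: "s powr - \<alpha> = q ^ k * y powr - \<alpha>"
      using assms(2) by (simp add: s_def q_def powr_mult powr_powr mult.commute flip: powr_realpow)
    have "(2 * s / cmod z) powr (2 - \<alpha>) / s\<^sup>2 = 2 powr (2 - \<alpha>) * (s powr (2 - \<alpha>) / s powr 2) * (1 / cmod z powr (2 - \<alpha>))"
      using s z by (simp add: powr_mult powr_divide powr_numeral)
    also have "s powr (2 - \<alpha>) / s powr 2 = s powr - \<alpha>"
      by (simp flip: powr_diff)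
    also have "1 / cmod z powr (2 - \<alpha>) = cmod z powr (\<alpha> - 2)"
      by (simp flip: powr_minus_divide)
    also have "2 powr (2 - \<alpha>) * s powr - \<alpha> * cmod z powr (\<alpha> - 2) = 2 powr (2 - \<alpha>) * (A * q ^ k)"
      by (simp add: s_powr A_def)
    also have "\<dots> \<le> 4 * (A * q ^ k)"
    proof (rule mult_right_mono)
      have "(2::real) powr (2 - \<alpha>) \<le> 2 powr 2"
        using assms(1) by (intro powr_mono) auto
      then show "(2::real) powr (2 - \<alpha>) \<le> 4" by simp
    qed (use A0 q in auto)
    finally have "(2 * s / cmod z) powr (2 - \<alpha>) / s\<^sup>2 \<le> 4 * (A * q ^ k)" .
    then have "e * ((2 * s / cmod z) powr (2 - \<alpha>) / s\<^sup>2) \<le> e * (4 * (A * q ^ k))"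
      using assms(4) by (rule mult_left_mono)
    moreover have "measure \<nu> (window z (2 * s)) / s\<^sup>2 \<le> e * (2 * s / cmod z) powr (2 - \<alpha>) / s\<^sup>2"
      using good[of "2 * s"] s by (intro divide_right_mono) auto
    ultimately show "measure \<nu> (window z (2 * (2 ^ k * y))) / (2 ^ k * y)\<^sup>2 \<le> 4 * e * A * q ^ k"
      by (simp add: s_def algebra_simps)
  qed
  also have "\<dots> = 4 * e * A * (\<Sum>k\<in>S. q ^ k)"
    by (simp add: sum_distrib_left)
  also have "\<dots> \<le> 4 * e * A * (1 / (1 - q))"
  proof (rule mult_left_mono)
    have "(\<Sum>k\<in>S. q ^ k) \<le> (\<Sum>k. q ^ k)"
      using q S(1) by (intro sum_le_suminf) auto
    then show "(\<Sum>k\<in>S. q ^ k) \<le> 1 / (1 - q)"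
      using q by (simp add: suminf_geometric)
  qed (use A0 assms in auto)
  finally show ?thesis by (simp add: A_def q_def algebra_simps)
qed

lemma dyadic_bound:
  fixes y d :: real
  assumes "0 < y" "y \<le> d"
  obtains k :: nat where "2 ^ k * y \<le> d" "d < 2 * (2 ^ k * y)"
proof -
  have "\<exists>k::nat. d / y < 2 ^ k" by (rule real_arch_pow) simp
  then obtain n :: nat where n: "d < 2 ^ n * y" using assms by (auto simp: field_simps)
  define k where "k = (LEAST n. d < 2 ^ n * y)"
  have k: "d < 2 ^ k * y" unfolding k_def by (rule LeastI[where P = "\<lambda>n. d < 2 ^ n * y", OF n])
  \<comment> \<open>The least such exponent is not 0 because y <= d; its predecessor is the exponent
    sought.\<close>
  with assms obtain j where j: "k = Suc j" by (cases k) auto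
  have "\<not> d < 2 ^ j * y" using not_less_Least[of j "\<lambda>n. d < 2 ^ n * y"] j by (simp add: k_def)
  then show thesis using k j by (intro that[of j]) auto
qed

text \<open>If |\<xi>| is not comparable with |z|, then |z - \<xi>| is at least (|\<xi>| + |z|) / 3
  and the first summand suffices. Otherwise \<xi> lies in an annulus 2^k y <= |z - \<xi>| < 2^(k+1)
  y, and the k-th term of the sum alone dominates 1 / |z - \<xi>|^2. Both cases lose a factor 9,
  hence 18 = 2 * 9.\<close>

lemma modified_poisson_kernel_dyadic_bound:
  fixes z :: complex and m :: nat
  defines "S \<equiv> {k::nat. 2 ^ k * Im z \<le> 3 * cmod z}"
  assumes "0 < Im z" "1 \<le> cmod z"
  shows "finite S"
    "\<bar>modified_poisson_kernel m z \<xi>\<bar> * (1 + \<bar>\<xi>\<bar> ^ (2 + m)) \<le> 18 * real (m + 1) * Im z * cmod z ^ m *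
      ((\<bar>\<xi>\<bar> + 1) / (\<bar>\<xi>\<bar> + cmod z) +
       (cmod z)\<^sup>2 * (\<Sum>k\<in>S. indicator (window z (2 * (2 ^ k * Im z))) \<xi> / (2 ^ k * Im z)\<^sup>2))"
proof -
  define y r d where "y = Im z" and "r = cmod z" and "d = cmod (z - of_real \<xi>)"
  define T where "T = (\<Sum>k\<in>S. indicator (window z (2 * (2 ^ k * y))) \<xi> / (2 ^ k * y)\<^sup>2)"
  have pos: "0 < y" "1 \<le> r" using assms by (auto simp: y_def r_def)
  have yd: "y \<le> d" using abs_Im_le_cmod[of "z - of_real \<xi>"] assms by (simp add: y_def d_def)
  have d: "0 < d" using pos yd by simp
  obtain n :: nat where "3 * r / y < 2 ^ n" using real_arch_pow[of 2 "3 * r / y"] by auto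
  then have n: "3 * r < 2 ^ n * y" using pos by (simp add: field_simps)
  have "k < n" if "k \<in> S" for k
  proof (rule ccontr)
    assume "\<not> k < n"
    then have "2 ^ n * y \<le> 2 ^ k * y" using pos by (intro mult_right_mono power_increasing) auto
    with n that show False by (simp add: S_def y_def r_def)
  qed
  then show fin: "finite S" by (meson finite_nat_iff_bounded lessThan_iff subsetI)
  have T0: "0 \<le> T" unfolding T_def by (intro sum_nonneg) simp
  have P0: "0 \<le> (\<bar>\<xi>\<bar> + 1) / (\<bar>\<xi>\<bar> + r)" using pos by simp
  have "(\<bar>\<xi>\<bar> + r) * (\<bar>\<xi>\<bar> + 1) / d\<^sup>2 \<le> 9 * ((\<bar>\<xi>\<bar> + 1) / (\<bar>\<xi>\<bar> + r) + r\<^sup>2 * T)"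
  proof (cases "r / 2 \<le> \<bar>\<xi>\<bar> \<and> \<bar>\<xi>\<bar> \<le> 2 * r")
    case True
    obtain k :: nat where k: "2 ^ k * y \<le> d" "d < 2 * (2 ^ k * y)"
      using dyadic_bound[OF pos(1) yd] .
    \<comment> \<open>Here |\<xi>| <= 2 r, so d <= 3 r; this explains the 3 in the definition of
      \<open>S\<close>.\<close>
    have "d \<le> r + \<bar>\<xi>\<bar>" unfolding d_def r_def using norm_triangle_ineq4[of z "of_real \<xi>"] by simp
    then have kS: "k \<in> S" using k True by (simp add: S_def y_def r_def)
    have "1 / d\<^sup>2 \<le> 1 / (2 ^ k * y)\<^sup>2"
      using k pos by (intro divide_left_mono power_mono mult_pos_pos) auto
    also have "\<dots> = indicator (window z (2 * (2 ^ k * y))) \<xi> / (2 ^ k * y)\<^sup>2"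
      using True k(2) by (simp add: window_def r_def d_def)
    also have "\<dots> \<le> T" unfolding T_def by (rule member_le_sum[OF kS _ fin]) simp
    finally have dT: "1 / d\<^sup>2 \<le> T" .
    have "(\<bar>\<xi>\<bar> + r) * (\<bar>\<xi>\<bar> + 1) / d\<^sup>2 = ((\<bar>\<xi>\<bar> + r) * (\<bar>\<xi>\<bar> + 1)) * (1 / d\<^sup>2)" by simp
    \<comment> \<open>The bound |\<xi>| + 1 <= 3 r uses r >= 1.\<close>
    also have "\<dots> \<le> ((3 * r) * (3 * r)) * T"
      using True pos dT d by (intro mult_mono) auto
    also have "\<dots> = 9 * (r\<^sup>2 * T)" by (simp add: power2_eq_square)
    also have "\<dots> \<le> 9 * ((\<bar>\<xi>\<bar> + 1) / (\<bar>\<xi>\<bar> + r) + r\<^sup>2 * T)"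
      using P0 by (intro mult_left_mono) auto
    finally show ?thesis .
  next
    case False
    have "\<bar>r - \<bar>\<xi>\<bar>\<bar> \<le> d" unfolding d_def r_def using norm_triangle_ineq3[of z "of_real \<xi>"] by simp
    \<comment> \<open>The constant 1/3 is attained at both cut-offs |\<xi>| = r / 2 and |\<xi>| = 2
      r.\<close>
    with False have "(\<bar>\<xi>\<bar> + r) / 3 \<le> d" by (auto simp: field_simps)
    then have "((\<bar>\<xi>\<bar> + r) / 3)\<^sup>2 \<le> d\<^sup>2" using pos by (intro power_mono) auto
    then have "(\<bar>\<xi>\<bar> + r) * (\<bar>\<xi>\<bar> + 1) / d\<^sup>2 \<le> (\<bar>\<xi>\<bar> + r) * (\<bar>\<xi>\<bar> + 1) / ((\<bar>\<xi>\<bar> + r) / 3)\<^sup>2"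
      using pos d by (intro divide_left_mono) (auto intro!: mult_pos_pos)
    also have "\<dots> = 9 * ((\<bar>\<xi>\<bar> + 1) / (\<bar>\<xi>\<bar> + r))"
      using pos by (simp add: power2_eq_square divide_simps)
    finally show ?thesis using T0 by (simp add: add_increasing2)
  qed
  then have "2 * real (m + 1) * y * r ^ m * ((\<bar>\<xi>\<bar> + r) * (\<bar>\<xi>\<bar> + 1) / d\<^sup>2)
      \<le> 2 * real (m + 1) * y * r ^ m * (9 * ((\<bar>\<xi>\<bar> + 1) / (\<bar>\<xi>\<bar> + r) + r\<^sup>2 * T))"
    using pos by (intro mult_left_mono) auto
  with modified_poisson_kernel_bound[OF assms(2,3), of m \<xi>]
  show "\<bar>modified_poisson_kernel m z \<xi>\<bar> * (1 + \<bar>\<xi>\<bar> ^ (2 + m)) \<le> 18 * real (m + 1) * Im z * cmod z ^ m *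
      ((\<bar>\<xi>\<bar> + 1) / (\<bar>\<xi>\<bar> + cmod z) +
       (cmod z)\<^sup>2 * (\<Sum>k\<in>S. indicator (window z (2 * (2 ^ k * Im z))) \<xi> / (2 ^ k * Im z)\<^sup>2))"
    unfolding y_def r_def d_def T_def by (simp only: mult.assoc)
qed

text \<open>If f is not integrable, its Bochner integral is 0 by convention and the bound is trivial.\<close>

lemma abs_integral_le_integral_bound:
  fixes f g :: "'a \<Rightarrow> real"
  assumes "integrable M g" "\<And>x. \<bar>f x\<bar> \<le> g x"
  shows "\<bar>integral\<^sup>L M f\<bar> \<le> integral\<^sup>L M g"
proof (cases "integrable M f")
  case True
  have "\<bar>integral\<^sup>L M f\<bar> \<le> (LINT x|M. \<bar>f x\<bar>)"
    using integral_norm_bound[of M f] by simp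
  also have "\<dots> \<le> integral\<^sup>L M g"
    using True assms by (intro integral_mono) auto
  finally show ?thesis .
next
  case False
  have "0 \<le> g x" for x using assms(2)[of x] by linarith
  then show ?thesis by (simp add: not_integrable_integral_eq[OF False])
qed

text \<open>The weight 1 + |\<xi>|^(2+m) in the kernel estimate cancels the denominator of
  \<open>h\<close>, so the integrand is dominated by \<open>h\<close> times the pointwise bound. Its
  Lebesgue integral is the \<nu>-integral of that bound, where indicators of windows turn into their
  masses.\<close>

lemma modified_poisson_integral_bound:
  fixes f :: "real \<Rightarrow> real" and m :: nat and z :: complex
  defines "h \<equiv> \<lambda>\<xi>. \<bar>f \<xi>\<bar> / (1 + \<bar>\<xi>\<bar> ^ (2 + m))"
  defines "\<nu> \<equiv> density lebesgue (\<lambda>\<xi>. ennreal (h \<xi>))"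
  defines "S \<equiv> {k::nat. 2 ^ k * Im z \<le> 3 * cmod z}"
  assumes h: "integrable lebesgue h" and z: "0 < Im z" "1 \<le> cmod z"
  shows "\<bar>modified_poisson_integral m f z\<bar> \<le> 18 * real (m + 1) * Im z * cmod z ^ m *
    ((LINT \<xi>|\<nu>. (\<bar>\<xi>\<bar> + 1) / (\<bar>\<xi>\<bar> + cmod z)) +
     (cmod z)\<^sup>2 * (\<Sum>k\<in>S. measure \<nu> (window z (2 * (2 ^ k * Im z))) / (2 ^ k * Im z)\<^sup>2))"
proof -
  define c where "c = 18 * real (m + 1) * Im z * cmod z ^ m"
  define a where "a = (\<lambda>\<xi>. (\<bar>\<xi>\<bar> + 1) / (\<bar>\<xi>\<bar> + cmod z))"
  define b where "b = (\<lambda>\<xi>. \<Sum>k\<in>S. indicator (window z (2 * (2 ^ k * Im z))) \<xi> / (2 ^ k * Im z)\<^sup>2 :: real)"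
  define B where "B = (\<lambda>\<xi>. c * (a \<xi> + (cmod z)\<^sup>2 * b \<xi>))"
  have h0: "0 \<le> h \<xi>" for \<xi> by (simp add: h_def)
  have h_meas: "h \<in> borel_measurable lebesgue" using h by simp
  have sets_\<nu>: "sets \<nu> = sets lebesgue" by (simp add: \<nu>_def)
  have borel_\<nu>: "g \<in> borel_measurable \<nu>" if "g \<in> borel_measurable borel" for g :: "real \<Rightarrow> real"
    using that by (simp add: \<nu>_def measurable_completion)
  have fin: "finite_measure \<nu>"
    unfolding \<nu>_def using h h0 by (intro finite_measureI)
      (simp add: emeasure_density nn_integral_eq_integral)
  interpret finite_measure \<nu> by fact
  have a_int: "integrable \<nu> a"
  proof (rule integrable_const_bound[where B = 1])
    show "AE \<xi> in \<nu>. norm (a \<xi>) \<le> 1"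
      using z by (intro AE_I2) (auto simp: a_def divide_simps)
    show "a \<in> borel_measurable \<nu>" unfolding a_def by (intro borel_\<nu>) measurable
  qed
  have W: "window z t \<in> sets \<nu>" for t
    using window_borel[of z t] by (simp add: sets_\<nu>)
  have ind: "integrable \<nu> (\<lambda>\<xi>. indicator (window z t) \<xi> / x :: real)"
    "(LINT \<xi>|\<nu>. indicator (window z t) \<xi> / x) = measure \<nu> (window z t) / x" for t x
    using W[of t] by (auto simp: integrable_indicator_iff emeasure_eq_measure)
  have b_int: "integrable \<nu> b"
    unfolding b_def by (intro Bochner_Integration.integrable_sum ind)
  have B_int: "integrable \<nu> B" unfolding B_def using a_int b_int by simp
  have B_meas: "B \<in> borel_measurable lebesgue"
    using borel_measurable_integrable[OF B_int] by (simp add: \<nu>_def)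
  have "\<bar>modified_poisson_integral m f z\<bar> \<le> (LINT \<xi>|lebesgue. h \<xi> *\<^sub>R B \<xi>)"
    unfolding modified_poisson_integral_def
  proof (rule abs_integral_le_integral_bound)
    show "integrable lebesgue (\<lambda>\<xi>. h \<xi> *\<^sub>R B \<xi>)"
      using B_int h0 unfolding \<nu>_def by (subst (asm) integrable_density[OF B_meas h_meas]) auto
    fix \<xi> :: real
    have "1 + \<bar>\<xi>\<bar> ^ (2 + m) > 0" using zero_le_power_abs[of \<xi> "2 + m"] by linarith
    then have "\<bar>modified_poisson_kernel m z \<xi> * f \<xi>\<bar> = (\<bar>modified_poisson_kernel m z \<xi>\<bar> * (1 + \<bar>\<xi>\<bar> ^ (2 + m))) * h \<xi>"
      by (simp add: h_def abs_mult)
    also have "\<dots> \<le> B \<xi> * h \<xi>"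
      unfolding B_def a_def b_def c_def S_def
      by (rule mult_right_mono[OF modified_poisson_kernel_dyadic_bound(2)[OF z] h0])
    finally show "\<bar>modified_poisson_kernel m z \<xi> * f \<xi>\<bar> \<le> h \<xi> *\<^sub>R B \<xi>" by (simp add: mult.commute)
  qed
  also have "\<dots> = integral\<^sup>L \<nu> B"
    unfolding \<nu>_def using h0 by (subst integral_density[OF B_meas h_meas]) auto
  also have "\<dots> = c * (integral\<^sup>L \<nu> a + (cmod z)\<^sup>2 * integral\<^sup>L \<nu> b)"
    unfolding B_def using a_int b_int by simp
  also have "integral\<^sup>L \<nu> b = (\<Sum>k\<in>S. measure \<nu> (window z (2 * (2 ^ k * Im z))) / (2 ^ k * Im z)\<^sup>2)"
    unfolding b_def by (simp only: Bochner_Integration.integral_sum[OF ind(1)] ind(2))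
  finally show ?thesis by (simp add: c_def a_def)
qed

text \<open>For r >= 1 the integrand is at most 1, an integrable bound since \<nu> is finite, and
  for fixed \<xi> it tends to 0; dominated convergence applies.\<close>

lemma tendsto_tail_weight_integral:
  fixes \<nu> :: "real measure"
  assumes "finite_measure \<nu>" "sets borel \<subseteq> sets \<nu>" "space \<nu> = UNIV"
  shows "((\<lambda>r. LINT \<xi>|\<nu>. (\<bar>\<xi>\<bar> + 1) / (\<bar>\<xi>\<bar> + r)) \<longlongrightarrow> 0) at_top"
proof -
  interpret finite_measure \<nu> by fact
  have borel_\<nu>: "g \<in> borel_measurable \<nu>" if "g \<in> borel_measurable borel" for g :: "real \<Rightarrow> real"
    using that assms(2,3) unfolding measurable_def by auto
  have "((\<lambda>r. LINT \<xi>|\<nu>. (\<bar>\<xi>\<bar> + 1) / (\<bar>\<xi>\<bar> + r)) \<longlongrightarrow> integral\<^sup>L \<nu> (\<lambda>\<xi>. 0)) at_top"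
  proof (rule integral_dominated_convergence_at_top[where w = "\<lambda>_. 1"])
    show "(\<lambda>\<xi>. (\<bar>\<xi>\<bar> + 1) / (\<bar>\<xi>\<bar> + r)) \<in> borel_measurable \<nu>" for r
      by (intro borel_\<nu>) measurable
    show "AE \<xi> in \<nu>. ((\<lambda>r. (\<bar>\<xi>\<bar> + 1) / (\<bar>\<xi>\<bar> + r)) \<longlongrightarrow> 0) at_top"
      by (intro AE_I2 tendsto_divide_0[OF tendsto_const] filterlim_at_top_imp_at_infinity
          filterlim_tendsto_add_at_top[OF tendsto_const] filterlim_ident)
    show "\<forall>\<^sub>F r in at_top. AE \<xi> in \<nu>. norm ((\<bar>\<xi>\<bar> + 1) / (\<bar>\<xi>\<bar> + r)) \<le> 1"
      using eventually_ge_at_top[of "1::real"]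
      by eventually_elim (auto simp: divide_simps)
  qed auto
  then show ?thesis by simp
qed

section \<open>The growth estimate outside the exceptional discs\<close>

theorem theorem1:
  fixes m :: nat and \<alpha> :: real and f :: "real \<Rightarrow> real" and v :: "complex \<Rightarrow> real"
  assumes "0 < \<alpha>" and "\<alpha> \<le> 2"
    and "f \<in> borel_measurable lebesgue"
    and "integrable lebesgue (\<lambda>\<xi>. \<bar>f \<xi>\<bar> / (1 + \<bar>\<xi>\<bar> ^ (2 + m)))"
    and "\<And>z. z \<in> upper_half_plane \<Longrightarrow> v z = modified_poisson_integral m f z"
  shows "\<exists>(N::enat) (c :: nat \<Rightarrow> complex) (\<rho> :: nat \<Rightarrow> real).
    (\<forall>j\<in>seq_index N. c j \<in> upper_half_plane \<and> \<rho> j > 0) \<and>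
    (\<lambda>j. \<rho> j powr (2 - \<alpha>) / cmod (c j) powr (2 - \<alpha>)) summable_on seq_index N \<and>
    little_o_at_infinity_within v
      (\<lambda>z. Im z powr (1 - \<alpha>) * cmod z powr (real m + \<alpha>))
      (upper_half_plane - (\<Union>j\<in>seq_index N. ball (c j) (\<rho> j)))"
proof -
  define h where "h = (\<lambda>\<xi>. \<bar>f \<xi>\<bar> / (1 + \<bar>\<xi>\<bar> ^ (2 + m)))"
  define \<nu> where "\<nu> = density lebesgue (\<lambda>\<xi>. ennreal (h \<xi>))"
  have h: "integrable lebesgue h" "\<And>\<xi>. 0 \<le> h \<xi>"
    using assms(4) by (auto simp: h_def)
  have fin: "finite_measure \<nu>"
    unfolding \<nu>_def using h by (intro finite_measureI)
      (simp add: emeasure_density nn_integral_eq_integral)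
  have sets: "sets borel \<subseteq> sets \<nu>" and space: "space \<nu> = UNIV"
    by (auto simp: \<nu>_def)
  obtain e N c \<rho> where e: "\<And>p. 0 < e p" "e \<longlonglongrightarrow> 0"
    and balls: "\<And>j. j \<in> seq_index N \<Longrightarrow> c j \<in> upper_half_plane \<and> 0 < \<rho> j"
    and sum: "(\<lambda>j. (\<rho> j / cmod (c j)) powr (2 - \<alpha>)) summable_on seq_index N"
    and good: "\<And>p z t. z \<in> upper_half_plane - (\<Union>j\<in>seq_index N. ball (c j) (\<rho> j)) \<Longrightarrow>
      2 ^ p \<le> cmod z \<Longrightarrow> cmod z < 2 ^ Suc p \<Longrightarrow> 0 < t \<Longrightarrow> t \<le> 6 * cmod z \<Longrightarrow>
      measure \<nu> (window z t) \<le> e p * (t / cmod z) powr (2 - \<alpha>)"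
    using exceptional_balls[OF fin sets] by blast
  define \<phi> where "\<phi> r = (LINT \<xi>|\<nu>. (\<bar>\<xi>\<bar> + 1) / (\<bar>\<xi>\<bar> + r))" for r
  define D where "D = 18 * real (m + 1)"
  define C where "C = 4 / (1 - 2 powr - \<alpha>)"
  define g where "g z = Im z powr (1 - \<alpha>) * cmod z powr (real m + \<alpha>)" for z
  have D0: "0 < D" by (simp add: D_def)
  have C0: "0 < C" using assms(1) by (simp add: C_def powr_less_one)
  \<comment> \<open>Both contributions are compared with \<open>g\<close>. The far part carries y
    |z|^m, which is at most \<open>g z\<close> because y^\<alpha> <= |z|^\<alpha>. In the near part
    y |z|^(m+2) times y^(-\<alpha>) |z|^(\<alpha>-2) is exactly \<open>g z\<close>.\<close>
  have bound: "\<bar>v z\<bar> \<le> D * (\<phi> (cmod z) + C * e p) * g z"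
    if z: "z \<in> upper_half_plane - (\<Union>j\<in>seq_index N. ball (c j) (\<rho> j))"
      and p: "2 ^ p \<le> cmod z" "cmod z < 2 ^ Suc p" for z p
  proof -
    define y r where "y = Im z" and "r = cmod z"
    have y: "0 < y" using z by (simp add: y_def upper_half_plane_def)
    have r1: "1 \<le> r" using p(1) order.trans[OF one_le_power[of "2::real" p]] by (simp add: r_def)
    have yr: "y \<le> r" using abs_Im_le_cmod[of z] by (simp add: y_def r_def)
    define S where "S = {k::nat. 2 ^ k * y \<le> 3 * r}"
    define T where "T = (\<Sum>k\<in>S. measure \<nu> (window z (2 * (2 ^ k * y))) / (2 ^ k * y)\<^sup>2)"
    have finS: "finite S"
      using modified_poisson_kernel_dyadic_bound(1)[of z] y r1 by (simp add: S_def y_def r_def)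
    have T: "T \<le> C * e p * (y powr - \<alpha> * r powr (\<alpha> - 2))"
      unfolding T_def C_def r_def
    proof (rule dyadic_window_sum[OF assms(1) y])
      show "measure \<nu> (window z t) \<le> e p * (t / cmod z) powr (2 - \<alpha>)"
        if "0 < t" "t \<le> 6 * cmod z" for t
        using good[OF z p that] .
    qed (use finS e(1)[of p] r1 in \<open>auto simp: S_def r_def\<close>)
    have \<phi>0: "0 \<le> \<phi> r" unfolding \<phi>_def using r1 by (intro integral_nonneg_AE AE_I2) auto
    have "v z = modified_poisson_integral m f z" using assms(5) z by simp
    then have "\<bar>v z\<bar> \<le> D * y * r ^ m * (\<phi> r + r\<^sup>2 * T)"
      using modified_poisson_integral_bound[OF h(1)[unfolded h_def], of z] y r1
      unfolding D_def T_def S_def y_def r_def \<phi>_def \<nu>_def h_def by simp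
    also have "\<dots> = D * (\<phi> r * (y * r ^ m) + (y * r ^ m * r\<^sup>2) * T)"
      by (simp add: algebra_simps)
    also have "\<dots> \<le> D * (\<phi> r * g z + (y * r ^ m * r\<^sup>2) * (C * e p * (y powr - \<alpha> * r powr (\<alpha> - 2))))"
    proof (intro mult_left_mono add_mono T)
      have "y * r ^ m = y powr (1 - \<alpha>) * (y powr \<alpha> * r powr m)"
        using y r1 by (simp add: powr_realpow flip: powr_add mult.assoc)
      also have "\<dots> \<le> y powr (1 - \<alpha>) * (r powr \<alpha> * r powr m)"
        using y yr assms(1) by (intro mult_left_mono mult_right_mono powr_mono2) auto
      also have "\<dots> = g z"
        by (simp add: g_def y_def r_def powr_add mult.commute)
      finally show "y * r ^ m \<le> g z" .
    qed (use D0 \<phi>0 y r1 in auto)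
    also have "(y * r ^ m * r\<^sup>2) * (C * e p * (y powr - \<alpha> * r powr (\<alpha> - 2))) = C * e p * g z"
    proof -
      have "y * y powr - \<alpha> = y powr (1 - \<alpha>)"
        using y by (simp add: powr_diff powr_minus_divide)
      moreover have "r ^ m * r\<^sup>2 * r powr (\<alpha> - 2) = r powr (m + \<alpha>)"
        using r1 by (simp add: powr_add powr_diff powr_realpow powr_numeral)
      moreover have "(y * r ^ m * r\<^sup>2) * (C * e p * (y powr - \<alpha> * r powr (\<alpha> - 2)))
          = C * e p * ((y * y powr - \<alpha>) * (r ^ m * r\<^sup>2 * r powr (\<alpha> - 2)))"
        by (simp only: mult_ac)
      ultimately show ?thesis
        by (simp add: g_def flip: y_def r_def)
    qed
    finally show ?thesis by (simp add: r_def algebra_simps)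
  qed
  have "little_o_at_infinity_within v g (upper_half_plane - (\<Union>j\<in>seq_index N. ball (c j) (\<rho> j)))"
    unfolding little_o_at_infinity_within_def
  proof (intro allI impI)
    fix \<epsilon> :: real assume \<epsilon>: "0 < \<epsilon>"
    have "(\<phi> \<longlongrightarrow> 0) at_top"
      unfolding \<phi>_def by (rule tendsto_tail_weight_integral[OF fin sets space])
    \<comment> \<open>The far part and the near part each receive half of the budget \<epsilon> /
      D.\<close>
    then have "\<forall>\<^sub>F r in at_top. \<phi> r < \<epsilon> / (2 * D)"
      using \<epsilon> D0 by (intro order_tendstoD(2)[where y = 0]) auto
    then obtain R where R: "\<And>r. R \<le> r \<Longrightarrow> \<phi> r < \<epsilon> / (2 * D)"
      by (auto simp: eventually_at_top_linorder)
    have "\<forall>\<^sub>F p in sequentially. e p < \<epsilon> / (2 * D * C)"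
      using \<epsilon> D0 C0 by (intro order_tendstoD(2)[OF e(2)]) auto
    then obtain q where q: "\<And>p. q \<le> p \<Longrightarrow> e p < \<epsilon> / (2 * D * C)"
      by (auto simp: eventually_sequentially)
    show "\<exists>R>0. \<forall>z\<in>upper_half_plane - (\<Union>j\<in>seq_index N. ball (c j) (\<rho> j)). R \<le> cmod z \<longrightarrow> \<bar>v z\<bar> \<le> \<epsilon> * g z"
    \<comment> \<open>A modulus of at least 2^(q+1) forces the shell index of z to be at least
      \<open>q\<close>, where \<open>e\<close> is already small.\<close>
    proof (intro exI[of _ "max R (2 ^ Suc q)"] conjI ballI impI)
      show "0 < max R (2 ^ Suc q)" by (simp add: less_max_iff_disj)
      fix z assume z: "z \<in> upper_half_plane - (\<Union>j\<in>seq_index N. ball (c j) (\<rho> j))"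
        and "max R (2 ^ Suc q) \<le> cmod z"
      then have zR: "R \<le> cmod z" "2 ^ Suc q \<le> cmod z" by auto
      then have "1 \<le> cmod z" using order.trans[OF one_le_power[of "2::real" "Suc q"]] by simp
      from dyadic_bound[OF zero_less_one this]
      obtain p :: nat where p: "2 ^ p \<le> cmod z" "cmod z < 2 ^ Suc p" by auto
      then have "(2::real) ^ Suc q < 2 ^ Suc p" using zR by linarith
      then have "q \<le> p" by simp
      then have "C * e p \<le> \<epsilon> / (2 * D)"
        using q[of p] D0 C0 by (simp add: field_simps)
      then have "D * (\<phi> (cmod z) + C * e p) \<le> D * (\<epsilon> / (2 * D) + \<epsilon> / (2 * D))"
        using R[OF zR(1)] D0 by (intro mult_left_mono add_mono) auto
      also have "\<dots> = \<epsilon>" using D0 by simp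
      finally have "D * (\<phi> (cmod z) + C * e p) * g z \<le> \<epsilon> * g z"
        by (rule mult_right_mono) (simp add: g_def)
      with bound[OF z p] show "\<bar>v z\<bar> \<le> \<epsilon> * g z" by linarith
    qed
  qed
  \<comment> \<open>For \<alpha> = 2 every term is a positive base to the power 0, hence 1, and
    summability then says that there are finitely many discs.\<close>
  moreover have "(\<lambda>j. \<rho> j powr (2 - \<alpha>) / cmod (c j) powr (2 - \<alpha>)) summable_on seq_index N"
  proof (rule summable_on_cong[THEN iffD1, OF _ sum])
    show "(\<rho> j / cmod (c j)) powr (2 - \<alpha>) = \<rho> j powr (2 - \<alpha>) / cmod (c j) powr (2 - \<alpha>)"
      if "j \<in> seq_index N" for j
      using balls[OF that] by (simp add: powr_divide)
  qed
  ultimately show ?thesis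
    using balls unfolding g_def by blast
qed

end
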